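(* The collection $\mathfrak{P} = \{\mathcal{P}_\sigma : \sigma\ge 2\}$ of the sets of potential signatures, partially ordered by the divisibility of $\sigma-1$ (that is, $\mathcal{P}_\sigma\le\mathcal{P}_{\sigma'}$ if and only if $(\sigma-1)\mid(\sigma'-1)$), forms a lattice.
   Context: Let $\sigma\ge 2$ be an integer. A tuple $(h; m_1,\ldots,m_r)$, where $h\ge 0$ and $r\ge 0$ are integers and $m_1,\ldots,m_r\ge 2$ are integers (written $(h;-)$ when $r=0$), is a potential signature for genus $\sigma$ if there exists a positive integer $N$ such that (1) $m_i \mid N$ for all $1\le i\le r$, and (2) the Riemann-Hurwitz formula holds: \[ \sigma - 1 = N\left( h-1+\frac12\sum_{i=1}^r\left(1-\frac1{m_i}\right)\right). \] No group action realizing the tuple is required to exist. $\mathcal{P}_\sigma$ denotes the set of all potential signatures for genus $\sigma$. A partially ordered set forms a lattice if each two-element subset has a greatest lower bound and a least upper bound. *)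

theory Defs
  imports Complex_Main "HOL-Algebra.Lattice"
begin

text \<open>A tuple \<open>(h; m\<^sub>1, \<dots>, m\<^sub>r)\<close> is represented by the pair \<open>(h, [m\<^sub>1, \<dots>, m\<^sub>r])\<close>;
  the tuple \<open>(h; -)\<close> is \<open>(h, [])\<close>.\<close>

type_synonym signature_tuple = "nat \<times> nat list"

text \<open>The Riemann-Hurwitz equation is stated in the reals, so that \<open>h - 1\<close> may be negative.\<close>

definition is_potential_signature :: "nat \<Rightarrow> signature_tuple \<Rightarrow> bool" where
  "is_potential_signature \<sigma> s \<longleftrightarrow> (case s of (h, ms) \<Rightarrow>
     (\<forall>m\<in>set ms. m \<ge> 2) \<and>
     (\<exists>N::nat. N > 0 \<and> (\<forall>m\<in>set ms. m dvd N) \<and>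
        real \<sigma> - 1 = real N * (real h - 1 + 1/2 * (\<Sum>m\<leftarrow>ms. 1 - 1 / real m))))"

definition potential_signatures :: "nat \<Rightarrow> signature_tuple set" where
  "potential_signatures \<sigma> = {s. is_potential_signature \<sigma> s}"

text \<open>The order is a relation between the sets themselves, hence the existential choice of
  representing genera. That it does not depend on this choice is not built into the definition.
  The subtractions are harmless because both genera are at least 2.\<close>

definition potential_signature_order :: "signature_tuple set gorder" where
  "potential_signature_order =
     \<lparr> carrier = {potential_signatures \<sigma> | \<sigma>. \<sigma> \<ge> 2},
       eq = (=),
       le = (\<lambda>A B. \<exists>\<sigma> \<sigma>'. \<sigma> \<ge> 2 \<and> \<sigma>' \<ge> 2 \<and>
               A = potential_signatures \<sigma> \<and> B = potential_signatures \<sigma>' \<and>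
               (\<sigma> - 1) dvd (\<sigma>' - 1)) \<rparr>"

end

theory Submission
  imports Defs
begin

text \<open>The unramified tuple \<open>(d + 1; -)\<close> lies in \<open>\<P>\<^sub>\<sigma>\<close> precisely when \<open>d\<close> divides
  \<open>\<sigma> - 1\<close>. Hence \<open>\<P>\<^sub>\<sigma>\<close> determines the set of divisors of \<open>\<sigma> - 1\<close>, and so \<open>\<sigma>\<close>
  itself, and the order is a copy of the divisibility order on the positive integers, where
  \<open>gcd\<close> and \<open>lcm\<close> are the lattice operations.\<close>

text \<open>With no periods, the condition on the \<open>m\<^sub>i\<close> is vacuous and
  Riemann-Hurwitz reduces to \<open>n = N * d\<close>, so \<open>N\<close> is merely a
  cofactor.\<close>

lemma unramified_mem_potential_signatures_iff:
  assumes "n > 0"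
  shows "(Suc d, []) \<in> potential_signatures (Suc n) \<longleftrightarrow> d dvd n"
proof -
  have "(Suc d, []) \<in> potential_signatures (Suc n) \<longleftrightarrow> (\<exists>N>0. real n = real (N * d))"
    by (simp add: potential_signatures_def is_potential_signature_def)
  also have "\<dots> \<longleftrightarrow> (\<exists>N>0. n = N * d)"
    by (simp only: of_nat_eq_iff)
  also have "\<dots> \<longleftrightarrow> d dvd n"
    \<comment> \<open>Since \<open>n > 0\<close>, a cofactor witnessing \<open>d dvd n\<close>
      cannot be 0, as the condition \<open>N > 0\<close> demands.\<close>
    using assms by (auto simp: dvd_def mult.commute intro: gr0I)
  finally show ?thesis .
qed

text \<open>The unramified tuples in the two sets show that \<open>m\<close> and \<open>n\<close>
  have the same divisors, so each divides the other. This injectivity makes the order independent of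
  the representing genera.\<close>

lemma potential_signatures_Suc_eq_iff:
  assumes "m > 0" "n > 0"
  shows "potential_signatures (Suc m) = potential_signatures (Suc n) \<longleftrightarrow> m = n"
proof
  assume eq: "potential_signatures (Suc m) = potential_signatures (Suc n)"
  have "d dvd m \<longleftrightarrow> d dvd n" for d
    using eq assms unramified_mem_potential_signatures_iff by metis
  then show "m = n"
    by (meson dvd_antisym dvd_refl)
qed simp

text \<open>Reindexing by \<open>n = \<sigma> - 1\<close> removes truncated subtraction from the
  lattice argument.\<close>

lemma carrier_potential_signature_order:
  "carrier potential_signature_order = {potential_signatures (Suc n) | n. n > 0}"
proof -
  have "(\<exists>\<sigma>\<ge>2. A = potential_signatures \<sigma>) \<longleftrightarrow> (\<exists>n>0. A = potential_signatures (Suc n))" for A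
  proof
    assume "\<exists>\<sigma>\<ge>2. A = potential_signatures \<sigma>"
    then obtain \<sigma> where "\<sigma> \<ge> 2" "A = potential_signatures \<sigma>"
      by blast
    then have "\<sigma> - 1 > 0" "A = potential_signatures (Suc (\<sigma> - 1))"
      by simp_all
    then show "\<exists>n>0. A = potential_signatures (Suc n)"
      by blast
  next
    assume "\<exists>n>0. A = potential_signatures (Suc n)"
    then obtain n where "n > 0" "A = potential_signatures (Suc n)"
      by blast
    then have "Suc n \<ge> 2" "A = potential_signatures (Suc n)"
      by simp_all
    then show "\<exists>\<sigma>\<ge>2. A = potential_signatures \<sigma>"
      by blast
  qed
  then show ?thesis
    unfolding potential_signature_order_def partial_object.simps by blast
qed

lemma potential_signatures_le_iff:
  assumes "m > 0" "n > 0"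
  shows "potential_signatures (Suc m) \<sqsubseteq>\<^bsub>potential_signature_order\<^esub> potential_signatures (Suc n)
    \<longleftrightarrow> m dvd n" (is "?L \<longleftrightarrow> _")
proof
  assume ?L
  then obtain \<sigma> \<sigma>' where "\<sigma> \<ge> 2" "\<sigma>' \<ge> 2"
    and eq: "potential_signatures (Suc m) = potential_signatures \<sigma>"
      "potential_signatures (Suc n) = potential_signatures \<sigma>'"
    and dvd: "\<sigma> - 1 dvd \<sigma>' - 1"
    by (auto simp: potential_signature_order_def)
  \<comment> \<open>By injectivity, the genera chosen by the existential in the order can only be
    \<open>Suc m\<close> and \<open>Suc n\<close>; the successor form lets that lemma apply.\<close>
  then obtain a b where "\<sigma> = Suc a" "a > 0" "\<sigma>' = Suc b" "b > 0"
    by (cases \<sigma>; cases \<sigma>') auto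
  with eq dvd assms show "m dvd n"
    by (simp add: potential_signatures_Suc_eq_iff)
next
  assume "m dvd n"
  then have "Suc m - 1 dvd Suc n - 1" "Suc m \<ge> 2" "Suc n \<ge> 2"
    using assms by auto
  then show ?L
    unfolding potential_signature_order_def gorder.simps by blast
qed

lemma partial_order_potential_signature_order: "partial_order potential_signature_order"
proof -
  \<comment> \<open>With equality as \<open>eq\<close>, the equivalence and congruence axioms are
    trivial; the rest are properties of \<open>dvd\<close>.\<close>
  have eq: "eq potential_signature_order = (=)"
    by (simp add: potential_signature_order_def)
  show ?thesis
    by unfold_locales
      (auto simp: eq carrier_potential_signature_order potential_signatures_le_iff
        dest: dvd_antisym elim: dvd_trans)
qed

lemma lattice_potential_signature_order: "lattice potential_signature_order"
proof -
  interpret partial_order potential_signature_order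
    by (rule partial_order_potential_signature_order)
  show ?thesis
  proof unfold_locales
    fix A B
    assume "A \<in> carrier potential_signature_order" "B \<in> carrier potential_signature_order"
    then obtain m n where mn: "m > 0" "n > 0"
      and AB: "A = potential_signatures (Suc m)" "B = potential_signatures (Suc n)"
      by (auto simp: carrier_potential_signature_order)
    let ?L = "potential_signature_order" and ?P = "\<lambda>k. potential_signatures (Suc k)"
    have pos: "lcm m n > 0" "gcd m n > 0"
      using mn by (simp_all add: lcm_pos_nat)
    have carr: "{A, B} \<subseteq> carrier ?L" "?P (lcm m n) \<in> carrier ?L" "?P (gcd m n) \<in> carrier ?L"
      using mn pos unfolding carrier_potential_signature_order AB by blast+
    have "least ?L (?P (lcm m n)) (Upper ?L {A, B})"
    proof (rule least_UpperI[OF _ _ carr(1,2)])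
      fix C assume "C \<in> {A, B}"
      then show "C \<sqsubseteq>\<^bsub>?L\<^esub> ?P (lcm m n)"
        unfolding AB using mn pos by (elim insertE emptyE) (simp_all add: potential_signatures_le_iff)
    next
      fix C assume "C \<in> Upper ?L {A, B}"
      then have "A \<sqsubseteq>\<^bsub>?L\<^esub> C" "B \<sqsubseteq>\<^bsub>?L\<^esub> C" "C \<in> carrier ?L"
        using carr(1) by (auto simp: Upper_def)
      \<comment> \<open>An index for \<open>C\<close> turns the two bounds into
        \<open>m dvd k\<close> and \<open>n dvd k\<close>, so the universal property of
        \<open>lcm\<close> applies; the \<open>gcd\<close> case is dual.\<close>
      moreover from this obtain k where "k > 0" "C = ?P k"
        unfolding carrier_potential_signature_order by blast
      ultimately show "?P (lcm m n) \<sqsubseteq>\<^bsub>?L\<^esub> C"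
        unfolding AB using mn pos by (simp add: potential_signatures_le_iff)
    qed
    then show "\<exists>s. least ?L s (Upper ?L {A, B})"
      by (rule exI)
    have "greatest ?L (?P (gcd m n)) (Lower ?L {A, B})"
    proof (rule greatest_LowerI[OF _ _ carr(1,3)])
      fix C assume "C \<in> {A, B}"
      then show "?P (gcd m n) \<sqsubseteq>\<^bsub>?L\<^esub> C"
        unfolding AB using mn pos by (elim insertE emptyE) (simp_all add: potential_signatures_le_iff)
    next
      fix C assume "C \<in> Lower ?L {A, B}"
      then have "C \<sqsubseteq>\<^bsub>?L\<^esub> A" "C \<sqsubseteq>\<^bsub>?L\<^esub> B" "C \<in> carrier ?L"
        using carr(1) by (auto simp: Lower_def)
      moreover from this obtain k where "k > 0" "C = ?P k"
        unfolding carrier_potential_signature_order by blast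
      ultimately show "C \<sqsubseteq>\<^bsub>?L\<^esub> ?P (gcd m n)"
        unfolding AB using mn pos by (simp add: potential_signatures_le_iff)
    qed
    then show "\<exists>s. greatest ?L s (Lower ?L {A, B})"
      by (rule exI)
  qed
qed

text \<open>The first conjunct confirms that the existential in the order yields the intended
  relation for every pair of genera.\<close>

theorem corollary3p4:
  "(\<forall>\<sigma> \<sigma>'. \<sigma> \<ge> 2 \<longrightarrow> \<sigma>' \<ge> 2 \<longrightarrow>
      (potential_signatures \<sigma> \<sqsubseteq>\<^bsub>potential_signature_order\<^esub> potential_signatures \<sigma>'
        \<longleftrightarrow> (\<sigma> - 1) dvd (\<sigma>' - 1)))
   \<and> lattice potential_signature_order"
proof (intro conjI allI impI)
  fix \<sigma> \<sigma>' :: nat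
  assume "\<sigma> \<ge> 2" "\<sigma>' \<ge> 2"
  then show "potential_signatures \<sigma> \<sqsubseteq>\<^bsub>potential_signature_order\<^esub> potential_signatures \<sigma>'
      \<longleftrightarrow> (\<sigma> - 1) dvd (\<sigma>' - 1)"
    using potential_signatures_le_iff[of "\<sigma> - 1" "\<sigma>' - 1"] by simp
qed (rule lattice_potential_signature_order)

end
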